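(* Let $M\in\mathbb{C}\setminus\{0,1,-1\}$. Then $(\tilde{\mathcal D}_M/\!\sim,\ \rhd)$ is a quandle.
   Context: Put $z=M-M^{-1}$, $m=\begin{pmatrix}M&1\\0&M^{-1}\end{pmatrix}$. $\mathcal D_M=\{A\in SL(2,\mathbb{C})\mid tr(A)=M+M^{-1}\}$; every element of $\mathcal D_M$ has the form $ama^{-1}$ with $a\in SL(2,\mathbb{C})$. $\tilde{\mathcal D}_M=\{A\in GL(2,\mathbb{C})\mid \det A=-M+M^{-1}\}$. For $a\in SL(2,\mathbb{C})$ with columns $a_1,a_2$, set $a_3=a_1-za_2$ and let $\tilde a=(a_1,a_3)$ be the matrix with columns $a_1,a_3$; $a\mapsto\tilde a$ is a bijection $SL(2,\mathbb{C})\to\tilde{\mathcal D}_M$. On $\tilde{\mathcal D}_M$, $\tilde a\sim\tilde b$ iff $\tilde b=\tilde a\begin{pmatrix}t&0\\0&t^{-1}\end{pmatrix}$ for some $t\in\mathbb{C}\setminus\{0\}$. The map $ama^{-1}\mapsto[\tilde a]$ is a bijection $\mathcal D_M\to\tilde{\mathcal D}_M/\!\sim$. The operation is defined by $[\tilde a]\rhd[\tilde b]=[\tilde c]$, where $x=ama^{-1}$, $y=bmb^{-1}$ and $c\in SL(2,\mathbb{C})$ is such that $cmc^{-1}=y^{-1}xy$. A quandle is a set with a binary operation $\rhd$ such that $p\rhd p=p$; $(p\rhd q)\rhd r=(p\rhd r)\rhd(q\rhd r)$; and for all $p,q$ there is a unique $r$ with $r\rhd q=p$. *)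

theory Defs
  imports "HOL-Analysis.Analysis"
begin

locale quandle =
  fixes Q :: "'q set" and tri :: "'q \<Rightarrow> 'q \<Rightarrow> 'q" (infixl "\<rhd>" 70)
  assumes closed: "\<lbrakk>p \<in> Q; q \<in> Q\<rbrakk> \<Longrightarrow> p \<rhd> q \<in> Q"
    and idem: "p \<in> Q \<Longrightarrow> p \<rhd> p = p"
    and self_distrib:
      "\<lbrakk>p \<in> Q; q \<in> Q; r \<in> Q\<rbrakk> \<Longrightarrow> (p \<rhd> q) \<rhd> r = (p \<rhd> r) \<rhd> (q \<rhd> r)"
    and right_div: "\<lbrakk>p \<in> Q; q \<in> Q\<rbrakk> \<Longrightarrow> \<exists>!r. r \<in> Q \<and> r \<rhd> q = p"

definition SL2 :: "(complex^2^2) set"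
  where "SL2 = {A. det A = 1}"

definition GL2 :: "(complex^2^2) set"
  where "GL2 = {A. invertible A}"

definition zM :: "complex \<Rightarrow> complex"
  where "zM M = M - inverse M"

(* vector lists the rows, so this is the upper triangular matrix (M, 1; 0, M^{-1}). *)
definition mM :: "complex \<Rightarrow> complex^2^2"
  where "mM M = vector [vector [M, 1], vector [0, inverse M]]"

definition tD :: "complex \<Rightarrow> (complex^2^2) set"
  where "tD M = {A \<in> GL2. det A = - M + inverse M}"

(* The transpose turns the listed rows into the columns a_1 and a_3 = a_1 - z a_2. *)
definition tilde :: "complex \<Rightarrow> complex^2^2 \<Rightarrow> complex^2^2"
  where "tilde M a = transpose (vector [column 1 a, column 1 a - zM M *s column 2 a])"

definition tsim :: "complex \<Rightarrow> ((complex^2^2) \<times> (complex^2^2)) set"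
  where "tsim M = {(A, B). A \<in> tD M \<and> B \<in> tD M \<and>
    (\<exists>t::complex. t \<noteq> 0 \<and> B = A ** vector [vector [t, 0], vector [0, inverse t]])}"

definition tclass :: "complex \<Rightarrow> complex^2^2 \<Rightarrow> (complex^2^2) set"
  where "tclass M A = tsim M `` {A}"

definition conj_m :: "complex \<Rightarrow> complex^2^2 \<Rightarrow> complex^2^2"
  where "conj_m M a = a ** mM M ** matrix_inv a"

(* All choices of a, b, c are allowed, so the description denotes a class only because
   the result does not depend on them. *)
definition tri_op ::
    "complex \<Rightarrow> (complex^2^2) set \<Rightarrow> (complex^2^2) set \<Rightarrow> (complex^2^2) set"
  where "tri_op M P Q = (THE R. \<exists>a\<in>SL2. \<exists>b\<in>SL2. \<exists>c\<in>SL2.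
    P = tclass M (tilde M a) \<and> Q = tclass M (tilde M b) \<and> R = tclass M (tilde M c) \<and>
    (let x = conj_m M a; y = conj_m M b in conj_m M c = matrix_inv y ** x ** y))"

end

theory Submission
  imports Defs
begin

text \<open>Put \<open>D = diag(M, M\<inverse>)\<close> and \<open>P = (1, 1; 0, -z)\<close>. The columns of \<open>P\<close> are eigenvectors of \<open>m\<close>,
  that is \<open>m P = P D\<close>, and \<open>\<tilde>a = a P\<close>; hence \<open>a m a\<inverse> = \<tilde>a D \<tilde>a\<inverse>\<close>. As \<open>M \<noteq> M\<inverse>\<close>, only diagonal matrices
  commute with \<open>D\<close>, so \<open>A \<sim> B\<close> iff \<open>A D A\<inverse> = B D B\<inverse>\<close>. The map \<open>[A] \<mapsto> A D A\<inverse>\<close> is thus injective on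
  classes, and since conjugating \<open>A D A\<inverse>\<close> by \<open>y\<close> with \<open>det y = 1\<close> replaces \<open>A\<close> by \<open>y\<inverse> A\<close>, it carries
  \<open>\<rhd>\<close> to the conjugation operation, for which the quandle laws are identities in the group
  \<open>GL(2, \<complex>)\<close>.\<close>

section \<open>Inverses and conjugation of invertible matrices\<close>

lemma matrix_inv_left: "matrix_inv A ** A = mat 1"
  and matrix_inv_right: "A ** matrix_inv A = mat 1"
  if "invertible (A :: 'a::semiring_1^'n^'n)"
  using someI_ex[OF that[unfolded invertible_def]] unfolding matrix_inv_def by auto

lemma matrix_inv_left_cancel: "matrix_inv A ** (A ** B) = B"
  and matrix_inv_right_cancel: "A ** (matrix_inv A ** B) = B"
  if "invertible (A :: 'a::semiring_1^'n^'n)"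
  by (simp_all add: matrix_mul_assoc matrix_inv_left matrix_inv_right that)

lemma matrix_inv_equality:
  fixes A B :: "'a::field^'n^'n"
  assumes "A ** B = mat 1"
  shows "matrix_inv A = B"
proof -
  have "invertible A"
    using assms invertible_right_inverse by blast
  then have "matrix_inv A ** (A ** B) = B"
    by (rule matrix_inv_left_cancel)
  then show ?thesis
    by (simp add: assms)
qed

lemma invertible_matrix_inv:
  "invertible (A :: 'a::semiring_1^'n^'n) \<Longrightarrow> invertible (matrix_inv A)"
  unfolding invertible_def[of "matrix_inv A"] using matrix_inv_left matrix_inv_right by blast

lemma matrix_inv_mult:
  fixes A B :: "'a::field^'n^'n"
  assumes "invertible A" "invertible B"
  shows "matrix_inv (A ** B) = matrix_inv B ** matrix_inv A"
  by (rule matrix_inv_equality)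
    (simp add: assms matrix_mul_assoc[symmetric] matrix_inv_right_cancel matrix_inv_right)

lemma matrix_inv_matrix_inv:
  "invertible (A :: 'a::field^'n^'n) \<Longrightarrow> matrix_inv (matrix_inv A) = A"
  by (rule matrix_inv_equality) (rule matrix_inv_left)

lemma det_matrix_inv:
  fixes A :: "'a::field^'n^'n"
  assumes "invertible A"
  shows "det (matrix_inv A) = inverse (det A)"
proof -
  have "det A * det (matrix_inv A) = 1"
    using assms by (simp add: det_mul[symmetric] matrix_inv_right)
  then show ?thesis
    by (metis inverse_unique)
qed

lemmas matrix_inv_simps =
  matrix_mul_assoc[symmetric] matrix_inv_left matrix_inv_right matrix_inv_left_cancel
  matrix_inv_right_cancel matrix_inv_mult matrix_inv_matrix_inv invertible_matrix_inv invertible_mult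

text \<open>Applying \<open>\<kappa>\<close> turns each law into an identity between conjugates of
  invertible matrices, and injectivity brings it back to \<open>Q\<close>. The assumption
  \<open>div\<close> says that the image of \<open>\<kappa>\<close> is also stable under the inverse
  conjugation, which yields the existence half of right division.\<close>

lemma quandle_if_conjugation:
  fixes \<kappa> :: "'q \<Rightarrow> 'a::field^'n^'n"
  assumes inj: "inj_on \<kappa> Q"
    and inv: "\<And>p. p \<in> Q \<Longrightarrow> invertible (\<kappa> p)"
    and closed: "\<And>p q. p \<in> Q \<Longrightarrow> q \<in> Q \<Longrightarrow> f p q \<in> Q"
    and conj: "\<And>p q. p \<in> Q \<Longrightarrow> q \<in> Q \<Longrightarrow> \<kappa> (f p q) = matrix_inv (\<kappa> q) ** \<kappa> p ** \<kappa> q"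
    and div: "\<And>p q. p \<in> Q \<Longrightarrow> q \<in> Q \<Longrightarrow> \<exists>r\<in>Q. \<kappa> r = \<kappa> q ** \<kappa> p ** matrix_inv (\<kappa> q)"
  shows "quandle Q f"
proof
  fix p q assume pq: "p \<in> Q" "q \<in> Q"
  show "f p q \<in> Q"
    using pq by (rule closed)
  show "\<exists>!r. r \<in> Q \<and> f r q = p"
  proof (rule ex_ex1I)
    obtain r where r: "r \<in> Q" "\<kappa> r = \<kappa> q ** \<kappa> p ** matrix_inv (\<kappa> q)"
      using div pq by blast
    then have "\<kappa> (f r q) = \<kappa> p"
      using pq by (simp add: conj inv matrix_inv_simps)
    then show "\<exists>r. r \<in> Q \<and> f r q = p"
      using r pq inj closed by (metis inj_onD)
  next
    fix r s assume rs: "r \<in> Q \<and> f r q = p" "s \<in> Q \<and> f s q = p"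
    \<comment> \<open>Conjugation by \<open>\<kappa> q\<close> can be undone, so
      \<open>f t q\<close> determines \<open>\<kappa> t\<close>.\<close>
    have "\<kappa> t = \<kappa> q ** \<kappa> (f t q) ** matrix_inv (\<kappa> q)" if "t \<in> Q" for t
      using that pq by (simp add: conj inv matrix_inv_simps)
    then have "\<kappa> r = \<kappa> s"
      using rs by metis
    then show "r = s"
      using rs inj by (metis inj_onD)
  qed
next
  fix p assume p: "p \<in> Q"
  then have "\<kappa> (f p p) = \<kappa> p"
    by (simp add: conj inv matrix_inv_simps)
  then show "f p p = p"
    using p inj closed by (metis inj_onD)
next
  fix p q r assume pqr: "p \<in> Q" "q \<in> Q" "r \<in> Q"
  then have "\<kappa> (f (f p q) r) = \<kappa> (f (f p r) (f q r))"
    by (simp add: conj inv closed matrix_inv_simps)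
  then show "f (f p q) r = f (f p r) (f q r)"
    using pqr inj closed by (metis inj_onD)
qed

section \<open>Diagonal matrices and conjugates of \<open>diag2 M\<close>\<close>

abbreviation diag2 :: "complex \<Rightarrow> complex^2^2"
  where "diag2 t \<equiv> vector [vector [t, 0], vector [0, inverse t]]"

text \<open>For invertible \<open>A\<close>, the matrix having the columns of \<open>A\<close> as
  eigenvectors for the eigenvalues \<open>M\<close> and \<open>inverse M\<close>.\<close>

definition eigen_conj :: "complex \<Rightarrow> complex^2^2 \<Rightarrow> complex^2^2"
  where "eigen_conj M A = A ** diag2 M ** matrix_inv A"

lemmas matrix2_simps = vec_eq_iff forall_2 sum_2 matrix_matrix_mult_def

lemma diag2_mult_inverse: "t \<noteq> 0 \<Longrightarrow> diag2 t ** diag2 (inverse t) = mat 1"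
  by (simp add: matrix2_simps mat_def)

lemma diag2_commute: "diag2 s ** diag2 t = diag2 t ** diag2 s"
  by (simp add: matrix2_simps mult.commute)

lemma invertible_diag2: "t \<noteq> 0 \<Longrightarrow> invertible (diag2 t)"
  using diag2_mult_inverse invertible_right_inverse by blast

text \<open>Comparing entries shows that \<open>M - inverse M\<close> annihilates both off-diagonal
  entries of \<open>C\<close>; the determinant then makes the diagonal entries mutually
  inverse.\<close>

lemma commutes_with_diag2:
  assumes "M \<noteq> inverse M" and "diag2 M ** C = C ** diag2 M" and "det C = 1"
  shows "C$1$1 \<noteq> 0" and "C = diag2 (C$1$1)"
proof -
  have "(M - inverse M) * C$1$2 = 0" "(M - inverse M) * C$2$1 = 0"
    using assms(2) by (auto simp: matrix2_simps algebra_simps)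
  with assms(1) have offdiag: "C$1$2 = 0" "C$2$1 = 0"
    by auto
  with assms(3) have "C$1$1 * C$2$2 = 1"
    by (simp add: det_2)
  then show "C$1$1 \<noteq> 0" and "C = diag2 (C$1$1)"
    using offdiag inverse_unique[of "C$1$1" "C$2$2"] by (auto simp: vec_eq_iff forall_2)
qed

lemma invertible_tD: "A \<in> tD M \<Longrightarrow> invertible A"
  by (simp add: tD_def GL2_def)

lemma mult_tD: "det y = 1 \<Longrightarrow> A \<in> tD M \<Longrightarrow> y ** A \<in> tD M"
  by (auto simp: tD_def GL2_def det_mul invertible_det_nz)

lemma eigen_conj_mult:
  assumes "invertible y" and "A \<in> tD M"
  shows "eigen_conj M (y ** A) = y ** eigen_conj M A ** matrix_inv y"
  using assms by (simp add: eigen_conj_def invertible_tD matrix_inv_simps)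

lemma tilde_eq_mult:
  "tilde M a = a ** vector [vector [1, 1], vector [0, - zM M]]"
  by (simp add: tilde_def matrix2_simps transpose_def column_def algebra_simps)

section \<open>Classes of \<open>tsim M\<close> and the operation on them\<close>

context
  fixes M :: complex
  assumes M: "M \<noteq> 0" "M \<noteq> 1" "M \<noteq> -1"
begin

lemma M_neq_inverse: "M \<noteq> inverse M"
proof
  assume "M = inverse M"
  then have "M * M = 1"
    using M(1) by (metis right_inverse)
  then show False
    using M square_eq_1_iff by blast
qed

lemma zM_nonzero: "zM M \<noteq> 0"
  using M_neq_inverse by (simp add: zM_def)

text \<open>The diagonal entries of \<open>diag2 M\<close> have product 1. By
  \<open>mult_tD\<close>, left multiplication by such a conjugate therefore stays in
  \<open>tD M\<close>.\<close>

lemma det_eigen_conj: "A \<in> tD M \<Longrightarrow> det (eigen_conj M A) = 1"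
  using invertible_tD[of A M] M(1)
  by (simp add: eigen_conj_def det_mul det_matrix_inv det_2[of "diag2 M"] invertible_det_nz)

lemma invertible_eigen_conj: "A \<in> tD M \<Longrightarrow> invertible (eigen_conj M A)"
  by (simp add: det_eigen_conj invertible_det_nz)

lemma tsim_iff:
  "(A, B) \<in> tsim M \<longleftrightarrow> A \<in> tD M \<and> B \<in> tD M \<and> eigen_conj M A = eigen_conj M B"
proof (intro iffI; (elim conjE)?)
  assume "(A, B) \<in> tsim M"
  then obtain t where AB: "A \<in> tD M" "B \<in> tD M" and t: "t \<noteq> 0" and B: "B = A ** diag2 t"
    by (auto simp: tsim_def)
  \<comment> \<open>Diagonal matrices commute, so the factors from \<open>B\<close> cancel around
    \<open>diag2 M\<close>. The trailing \<open>X\<close> lets the identity rewrite inside a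
    right-associated product.\<close>
  have "diag2 t ** (diag2 M ** (matrix_inv (diag2 t) ** X)) = diag2 M ** X"
    for X :: "complex^2^2"
    using t by (simp add: matrix_mul_assoc diag2_commute[of t M])
      (simp add: matrix_inv_simps invertible_diag2)
  then have "eigen_conj M B = eigen_conj M A"
    unfolding eigen_conj_def B using AB t
    by (simp add: matrix_inv_simps invertible_diag2 invertible_tD)
  with AB show "A \<in> tD M \<and> B \<in> tD M \<and> eigen_conj M A = eigen_conj M B"
    by simp
next
  assume A: "A \<in> tD M" and B: "B \<in> tD M" and eq: "eigen_conj M A = eigen_conj M B"
  \<comment> \<open>\<open>C\<close> is the factor leading from \<open>A\<close> to
    \<open>B\<close>. Equal conjugates make it commute with \<open>diag2 M\<close>, and the common
    determinant on \<open>tD M\<close> gives it determinant 1.\<close>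
  define C where "C = matrix_inv A ** B"
  have "diag2 M ** C = matrix_inv A ** eigen_conj M A ** B"
    using A by (simp add: C_def eigen_conj_def matrix_inv_simps invertible_tD)
  also have "\<dots> = C ** diag2 M"
    using B unfolding eq by (simp add: C_def eigen_conj_def matrix_inv_simps invertible_tD)
  finally have comm: "diag2 M ** C = C ** diag2 M" .
  have "det A = det B" "det A \<noteq> 0"
    using A B by (auto simp: tD_def GL2_def invertible_det_nz)
  then have "det C = 1"
    using A by (simp add: C_def det_mul det_matrix_inv invertible_tD)
  note C = commutes_with_diag2[OF M_neq_inverse comm this]
  have "B = A ** C"
    using A by (simp add: C_def matrix_inv_right_cancel invertible_tD)
  \<comment> \<open>\<open>C\<close> occurs on both sides of its own description, so only the outer
    occurrence is replaced.\<close>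
  then have "B = A ** diag2 (C$1$1)"
    using C(2) by (rule back_subst[where P = "\<lambda>X. B = A ** X"])
  then show "(A, B) \<in> tsim M"
    using A B C(1) by (auto simp: tsim_def)
qed

lemma equiv_tsim: "equiv (tD M) (tsim M)"
  by (auto intro!: equivI refl_onI symI transI simp: tsim_iff)

lemma tclass_eq_iff:
  "A \<in> tD M \<Longrightarrow> B \<in> tD M \<Longrightarrow> tclass M A = tclass M B \<longleftrightarrow> eigen_conj M A = eigen_conj M B"
  unfolding tclass_def by (simp add: eq_equiv_class_iff[OF equiv_tsim] tsim_iff)

lemma tilde_in_tD: "a \<in> SL2 \<Longrightarrow> tilde M a \<in> tD M"
  using zM_nonzero
  by (simp add: tilde_eq_mult tD_def GL2_def SL2_def invertible_det_nz det_mul)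
    (simp add: det_2 zM_def)

lemma tilde_surj:
  assumes "A \<in> tD M"
  obtains a where "a \<in> SL2" "A = tilde M a"
proof
  \<comment> \<open>The second factor is the inverse of the matrix \<open>P\<close> with
    \<open>tilde M a = a ** P\<close>.\<close>
  let ?a = "A ** vector [vector [1, inverse (zM M)], vector [0, - inverse (zM M)]]"
  have "det A = - zM M"
    using assms by (simp add: tD_def zM_def)
  then show "?a \<in> SL2"
    using zM_nonzero by (simp add: SL2_def det_mul) (simp add: det_2)
  have "(vector [vector [1, inverse (zM M)], vector [0, - inverse (zM M)]] :: complex^2^2) **
      vector [vector [1, 1], vector [0, - zM M]] = mat 1"
    using zM_nonzero by (simp add: matrix2_simps mat_def)
  then show "A = tilde M ?a"
    by (simp add: tilde_eq_mult matrix_mul_assoc[symmetric])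
qed

lemma conj_m_eq_eigen_conj:
  assumes "a \<in> SL2"
  shows "conj_m M a = eigen_conj M (tilde M a)"
proof -
  let ?P = "vector [vector [1, 1], vector [0, - zM M]] :: complex^2^2"
  have a: "invertible a"
    using assms by (simp add: SL2_def invertible_det_nz)
  have P: "invertible ?P"
    using zM_nonzero by (simp add: invertible_det_nz det_2)
  \<comment> \<open>The columns (1, 0) and (1, -z) are eigenvectors of \<open>mM M\<close> for
    \<open>M\<close> and \<open>inverse M\<close>.\<close>
  have "mM M ** ?P = ?P ** diag2 M"
    by (simp add: mM_def matrix2_simps zM_def algebra_simps)
  then have "?P ** (diag2 M ** (matrix_inv ?P ** X)) = mM M ** X" for X :: "complex^2^2"
    using P by (simp add: matrix_mul_assoc flip: \<open>mM M ** ?P = _\<close>) (simp add: matrix_inv_simps)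
  then show ?thesis
    unfolding conj_m_def eigen_conj_def tilde_eq_mult matrix_inv_mult[OF a P]
    by (simp only: matrix_mul_assoc[symmetric])
qed

text \<open>Resolves the definite description in \<open>tri_op\<close> by an explicit
  representative: conjugating by y amounts to multiplying \<open>A\<close> on the left by the
  inverse of y.\<close>

lemma tri_op_tclass:
  assumes A: "A \<in> tD M" and B: "B \<in> tD M"
  shows "tri_op M (tclass M A) (tclass M B) = tclass M (matrix_inv (eigen_conj M B) ** A)"
    and "matrix_inv (eigen_conj M B) ** A \<in> tD M"
    and "eigen_conj M (matrix_inv (eigen_conj M B) ** A) =
      matrix_inv (eigen_conj M B) ** eigen_conj M A ** eigen_conj M B"
proof -
  let ?C = "matrix_inv (eigen_conj M B) ** A"
  show C: "?C \<in> tD M"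
    using A B by (simp add: mult_tD det_matrix_inv invertible_eigen_conj det_eigen_conj)
  show conj: "eigen_conj M ?C = matrix_inv (eigen_conj M B) ** eigen_conj M A ** eigen_conj M B"
    using A B by (simp add: eigen_conj_mult invertible_eigen_conj invertible_matrix_inv
        matrix_inv_matrix_inv)
  obtain a b c where abc: "a \<in> SL2" "A = tilde M a" "b \<in> SL2" "B = tilde M b"
    "c \<in> SL2" "?C = tilde M c"
    using tilde_surj A B C by metis
  show "tri_op M (tclass M A) (tclass M B) = tclass M ?C"
    unfolding tri_op_def
  proof (rule the_equality)
    show "\<exists>a\<in>SL2. \<exists>b\<in>SL2. \<exists>c\<in>SL2.
      tclass M A = tclass M (tilde M a) \<and> tclass M B = tclass M (tilde M b) \<and>
      tclass M ?C = tclass M (tilde M c) \<and>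
      (let x = conj_m M a; y = conj_m M b in conj_m M c = matrix_inv y ** x ** y)"
      using abc conj by (metis conj_m_eq_eigen_conj)
  next
    fix R
    assume "\<exists>a\<in>SL2. \<exists>b\<in>SL2. \<exists>c\<in>SL2.
      tclass M A = tclass M (tilde M a) \<and> tclass M B = tclass M (tilde M b) \<and>
      R = tclass M (tilde M c) \<and>
      (let x = conj_m M a; y = conj_m M b in conj_m M c = matrix_inv y ** x ** y)"
    \<comment> \<open>The two classes fix x and y whatever \<open>a\<close> and \<open>b\<close> are
      chosen. Hence the conjugate given by \<open>c\<close> is fixed as well, and it determines the
      class \<open>R\<close>.\<close>
    then obtain a b c where "a \<in> SL2" "b \<in> SL2" and c: "c \<in> SL2" "R = tclass M (tilde M c)"
      and "eigen_conj M A = eigen_conj M (tilde M a)" "eigen_conj M B = eigen_conj M (tilde M b)"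
      and "conj_m M c = matrix_inv (conj_m M b) ** conj_m M a ** conj_m M b"
      using A B by (auto simp: Let_def tilde_in_tD tclass_eq_iff)
    then have "eigen_conj M (tilde M c) = eigen_conj M ?C"
      using conj by (simp add: conj_m_eq_eigen_conj)
    then show "R = tclass M ?C"
      using c C by (simp add: tilde_in_tD tclass_eq_iff)
  qed
qed

lemma quandle_tri_op: "quandle (tD M // tsim M) (tri_op M)"
proof (rule quandle_if_conjugation)
  let ?Q = "tD M // tsim M"
  \<comment> \<open>An arbitrary representative serves, since \<open>eigen_conj M\<close> is
    constant on each class.\<close>
  let ?\<kappa> = "\<lambda>P. eigen_conj M (SOME A. A \<in> P)"
  have rep: "\<exists>A\<in>tD M. P = tclass M A" if "P \<in> ?Q" for P
    using that by (auto simp: quotient_def tclass_def)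
  have tclass_mem: "tclass M A \<in> ?Q" if "A \<in> tD M" for A
    using that by (auto simp: quotient_def tclass_def)
  have \<kappa>: "?\<kappa> (tclass M A) = eigen_conj M A" if "A \<in> tD M" for A
  proof -
    have "A \<in> tclass M A"
      using that by (simp add: tclass_def tsim_iff)
    moreover have "eigen_conj M B = eigen_conj M A" if "B \<in> tclass M A" for B
      using that by (simp add: tclass_def tsim_iff)
    ultimately show ?thesis
      by (rule someI2)
  qed
  show "inj_on ?\<kappa> ?Q"
  proof (rule inj_onI)
    fix P R assume "P \<in> ?Q" "R \<in> ?Q" and "?\<kappa> P = ?\<kappa> R"
    moreover from this obtain A B
      where "A \<in> tD M" "P = tclass M A" and "B \<in> tD M" "R = tclass M B"
      using rep by metis
    ultimately show "P = R"
      by (simp add: \<kappa> tclass_eq_iff)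
  qed
  show "invertible (?\<kappa> p)" if "p \<in> ?Q" for p
    using rep[OF that] by (auto simp: \<kappa> invertible_eigen_conj)
  fix p q assume "p \<in> ?Q" "q \<in> ?Q"
  then obtain A B where A: "A \<in> tD M" "p = tclass M A" and B: "B \<in> tD M" "q = tclass M B"
    using rep by blast
  show "tri_op M p q \<in> ?Q"
    using A B by (simp add: tri_op_tclass tclass_mem)
  show "?\<kappa> (tri_op M p q) = matrix_inv (?\<kappa> q) ** ?\<kappa> p ** ?\<kappa> q"
    using A B by (simp add: tri_op_tclass \<kappa>)
  \<comment> \<open>Multiplying by y instead of its inverse gives the opposite conjugation, hence
    the witness for \<open>div\<close>.\<close>
  have "eigen_conj M B ** A \<in> tD M"
    using A B by (simp add: mult_tD det_eigen_conj)
  then show "\<exists>r\<in>?Q. ?\<kappa> r = ?\<kappa> q ** ?\<kappa> p ** matrix_inv (?\<kappa> q)"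
    using A B
    by (intro bexI[of _ "tclass M (eigen_conj M B ** A)"])
      (simp_all add: \<kappa> tclass_mem eigen_conj_mult invertible_eigen_conj)
qed

end

theorem proposition2p9:
  fixes M :: complex
  assumes "M \<noteq> 0" and "M \<noteq> 1" and "M \<noteq> -1"
  shows "quandle (tD M // tsim M) (tri_op M)"
  using assms by (rule quandle_tri_op)

end
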